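(* Let $\mu\in\mathcal{P}$ be a parameter and $\varphi_\mu^*(T)\in X$ the optimal final time adjoint. Let $\Phi^k=\{\varphi_1,\dots,\varphi_k\}\subset X$ be a reduced basis with reduced space $X^k=\operatorname{span}(\Phi^k)$, and let $\tilde\varphi_\mu^k\in X^k$ be the associated approximate final time adjoint (defined in the context). Then $$\operatorname{dist}(X^k,\{\varphi_\mu^*(T)\})\;\le\;\eta_\mu(\tilde\varphi_\mu^k)\;\le\;\|I+M\Lambda_\mu^R\|_{\mathcal{L}(X,X)}\cdot\operatorname{dist}(X^k,\{\varphi_\mu^*(T)\}).$$
   Context: $X$ and $U$ are real Hilbert spaces (possibly infinite-dimensional), and $\mathcal{L}(V,W)$ denotes the bounded linear operators from $V$ to $W$; $I$ is the identity on $X$; norms without index are those of $X$. $T>0$ is a final time. $\mathcal{P}$ is a compact subset of a Banach space. For each $\mu\in\mathcal{P}$ we are given $A_\mu\in\mathcal{L}(X,X)$, $B_\mu\in\mathcal{L}(U,X)$, an initial state $x_\mu^0\in X$ and a target state $x_\mu^T\in X$; the four maps $\mu\mapsto A_\mu,\ B_\mu,\ x_\mu^0,\ x_\mu^T$ are Lipschitz continuous on $\mathcal{P}$. $M\in\mathcal{L}(X,X)$ is self-adjoint and positive-semidefinite; $R\in\mathcal{L}(U,U)$ is self-adjoint with $R\ge\alpha I$ for some $\alpha>0$. $A^*$ denotes the Hilbert space adjoint. The weighted controllability Gramian is $$\Lambda_\mu^R:=\int_0^T e^{A_\mu(T-s)}B_\mu R^{-1}B_\mu^*e^{A_\mu^*(T-s)}\,ds\in\mathcal{L}(X,X).$$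 Standing assumption: for all $\mu\in\mathcal{P}$ the operator $M\Lambda_\mu^R$ is positive-semidefinite, i.e. $\langle M\Lambda_\mu^R p,p\rangle\ge 0$ for all $p\in X$. The optimal final time adjoint $\varphi_\mu^*(T)\in X$ is the value at time $T$ of the adjoint state of the optimality system $\dot x=A_\mu x+B_\mu u$, $-\dot\varphi=A_\mu^*\varphi$, $u=-R^{-1}B_\mu^*\varphi$ on $[0,T]$, $x(0)=x_\mu^0$, $\varphi(T)=M(x(T)-x_\mu^T)$; equivalently, it is the solution of $(I+M\Lambda_\mu^R)\varphi_\mu^*(T)=M(e^{A_\mu T}x_\mu^0-x_\mu^T)$. The error estimator is $\eta_\mu(p):=\|M(e^{A_\mu T}x_\mu^0-x_\mu^T)-(I+M\Lambda_\mu^R)p\|$ for $p\in X$. For a subspace $Y\subset X$ and a compact set $Z\subset X$, $\operatorname{dist}(Y,Z):=\sup_{z\in Z}\inf_{y\in Y}\|y-z\|$. Reduced basis: $\varphi_1,\dots,\varphi_k$ are linearly independent and are optimal final time adjoints $\varphi_{\mu_1}^*(T),\dots,\varphi_{\mu_k}^*(T)$ for selected parameters $\mu_1,\dots,\mu_k\in\mathcal{P}$ (possibly orthonormalized by Gram–Schmidt, which does not change their span). Approximate final time adjoint: let $x_i^\mu:=(I+M\Lambda_\mu^R)\varphi_i$ for $i=1,\dots,k$, and $Y_\mu^k:=\operatorname{span}(x_1^\mu,\dots,x_k^\mu)=(I+M\Lambda_\mu^R)X^k$. The vectors $x_1^\mu,\dots,x_k^\mu$ are linearly independent. Let $P_{Y_\mu^k}$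 be the orthogonal projection of $X$ onto $Y_\mu^k$ and let $\alpha_1^\mu,\dots,\alpha_k^\mu\in\mathbb{R}$ be the coefficients with $P_{Y_\mu^k}\big(M(e^{A_\mu T}x_\mu^0-x_\mu^T)\big)=\sum_{i=1}^k\alpha_i^\mu x_i^\mu$. Then $\tilde\varphi_\mu^k:=\sum_{i=1}^k\alpha_i^\mu\varphi_i$. *)

theory Defs
  imports "HOL-Analysis.Analysis"
begin

text \<open>Hilbert spaces are rendered by the sort \<open>{real_inner, banach}\<close>, bounded operators by
  \<^typ>\<open>'a \<Rightarrow>\<^sub>L 'b\<close> with the operator norm. On these spaces the adjoint of a bounded operator exists,
  is unique and is bounded, so the \<^const>\<open>Blinfun\<close> below does not produce a junk value.\<close>

definition hilbert_adjoint ::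
  "('a::{real_inner,banach} \<Rightarrow>\<^sub>L 'b::{real_inner,banach}) \<Rightarrow> ('b \<Rightarrow>\<^sub>L 'a)" where
  "hilbert_adjoint A = Blinfun (adjoint (blinfun_apply A))"

text \<open>Used only for boundedly invertible operators.\<close>

definition blinfun_inverse :: "('a::real_normed_vector \<Rightarrow>\<^sub>L 'a) \<Rightarrow> ('a \<Rightarrow>\<^sub>L 'a)" where
  "blinfun_inverse R = Blinfun (inv (blinfun_apply R))"

text \<open>The library's \<^const>\<open>exp\<close> needs a unital normed algebra with \<open>norm 1 = 1\<close>, of which
  the type of endomorphisms is not an instance; hence the exponential series is written out.\<close>

definition blinfun_exp :: "('a::banach \<Rightarrow>\<^sub>L 'a) \<Rightarrow> ('a \<Rightarrow>\<^sub>L 'a)" where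
  "blinfun_exp A = (\<Sum>n. (1 / fact n) *\<^sub>R ((\<lambda>C. A o\<^sub>L C) ^^ n) id_blinfun)"

definition self_adjoint :: "('a::{real_inner,banach} \<Rightarrow>\<^sub>L 'a) \<Rightarrow> bool" where
  "self_adjoint A \<longleftrightarrow> hilbert_adjoint A = A"

text \<open>No symmetry is required here; \<open>M \<Lambda>\<close> need not be self-adjoint.\<close>

definition pos_semidef :: "('a::real_inner \<Rightarrow>\<^sub>L 'a) \<Rightarrow> bool" where
  "pos_semidef A \<longleftrightarrow> (\<forall>p. 0 \<le> inner (blinfun_apply A p) p)"

definition gramian ::
  "real \<Rightarrow> ('x::{real_inner,banach} \<Rightarrow>\<^sub>L 'x) \<Rightarrow> ('u::{real_inner,banach} \<Rightarrow>\<^sub>L 'x)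
    \<Rightarrow> ('u \<Rightarrow>\<^sub>L 'u) \<Rightarrow> ('x \<Rightarrow>\<^sub>L 'x)" where
  "gramian T A B R = integral {0..T} (\<lambda>s.
     blinfun_exp ((T - s) *\<^sub>R A) o\<^sub>L B o\<^sub>L blinfun_inverse R o\<^sub>L hilbert_adjoint B
       o\<^sub>L blinfun_exp ((T - s) *\<^sub>R hilbert_adjoint A))"

definition system_op ::
  "real \<Rightarrow> ('x::{real_inner,banach} \<Rightarrow>\<^sub>L 'x) \<Rightarrow> ('u::{real_inner,banach} \<Rightarrow>\<^sub>L 'x)
    \<Rightarrow> ('u \<Rightarrow>\<^sub>L 'u) \<Rightarrow> ('x \<Rightarrow>\<^sub>L 'x) \<Rightarrow> ('x \<Rightarrow>\<^sub>L 'x)" where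
  "system_op T A B R M = id_blinfun + (M o\<^sub>L gramian T A B R)"

definition system_rhs ::
  "real \<Rightarrow> ('x::{real_inner,banach} \<Rightarrow>\<^sub>L 'x) \<Rightarrow> ('x \<Rightarrow>\<^sub>L 'x) \<Rightarrow> 'x \<Rightarrow> 'x \<Rightarrow> 'x" where
  "system_rhs T A M x0 xT = blinfun_apply M (blinfun_apply (blinfun_exp (T *\<^sub>R A)) x0 - xT)"

definition optimal_final_adjoint ::
  "real \<Rightarrow> ('x::{real_inner,banach} \<Rightarrow>\<^sub>L 'x) \<Rightarrow> ('u::{real_inner,banach} \<Rightarrow>\<^sub>L 'x)
    \<Rightarrow> ('u \<Rightarrow>\<^sub>L 'u) \<Rightarrow> ('x \<Rightarrow>\<^sub>L 'x) \<Rightarrow> 'x \<Rightarrow> 'x \<Rightarrow> 'x \<Rightarrow> bool" where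
  "optimal_final_adjoint T A B R M x0 xT p \<longleftrightarrow>
    (\<exists>(x :: real \<Rightarrow> 'x) (\<phi> :: real \<Rightarrow> 'x) (u :: real \<Rightarrow> 'u).
       (\<forall>t\<in>{0..T}.
          (x has_vector_derivative (blinfun_apply A (x t) + blinfun_apply B (u t))) (at t within {0..T}) \<and>
          (\<phi> has_vector_derivative - blinfun_apply (hilbert_adjoint A) (\<phi> t)) (at t within {0..T}) \<and>
          u t = - blinfun_apply (blinfun_inverse R) (blinfun_apply (hilbert_adjoint B) (\<phi> t))) \<and>
       x 0 = x0 \<and> \<phi> T = blinfun_apply M (x T - xT) \<and> p = \<phi> T)"

definition error_estimator ::
  "real \<Rightarrow> ('x::{real_inner,banach} \<Rightarrow>\<^sub>L 'x) \<Rightarrow> ('u::{real_inner,banach} \<Rightarrow>\<^sub>L 'x)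
    \<Rightarrow> ('u \<Rightarrow>\<^sub>L 'u) \<Rightarrow> ('x \<Rightarrow>\<^sub>L 'x) \<Rightarrow> 'x \<Rightarrow> 'x \<Rightarrow> 'x \<Rightarrow> real" where
  "error_estimator T A B R M x0 xT p =
     norm (system_rhs T A M x0 xT - blinfun_apply (system_op T A B R M) p)"

definition set_deviation :: "'a::real_normed_vector set \<Rightarrow> 'a set \<Rightarrow> real" where
  "set_deviation Y Z = (SUP z\<in>Z. INF y\<in>Y. norm (y - z))"

text \<open>For a complete subspace \<open>Y\<close>; the library's \<^const>\<open>closest_point\<close> requires
  the sort \<open>heine_borel\<close>, i.e. excludes infinite-dimensional spaces.\<close>

definition orth_proj :: "'a::real_inner set \<Rightarrow> 'a \<Rightarrow> 'a" where
  "orth_proj Y b = (THE y. y \<in> Y \<and> (\<forall>z\<in>Y. inner (b - y) z = 0))"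

text \<open>Linear independence of a family; the injectivity excludes repeated vectors.\<close>

definition lin_indep_family :: "nat \<Rightarrow> (nat \<Rightarrow> 'a::real_vector) \<Rightarrow> bool" where
  "lin_indep_family k \<phi> \<longleftrightarrow> inj_on \<phi> {1..k} \<and> independent (\<phi> ` {1..k})"

text \<open>Gram-Schmidt orthonormalization of \<open>\<psi> 1, \<psi> 2, \<dots>\<close>; note \<open>sgn v = v / norm v\<close>.\<close>

function gram_schmidt :: "(nat \<Rightarrow> 'a::real_inner) \<Rightarrow> nat \<Rightarrow> 'a" where
  "gram_schmidt \<psi> i =
     sgn (\<psi> i - (\<Sum>j\<in>{1..<i}. inner (\<psi> i) (gram_schmidt \<psi> j) *\<^sub>R gram_schmidt \<psi> j))"
  by auto
termination
  by (relation "Wellfounded.measure snd") auto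

declare gram_schmidt.simps [simp del]

definition reduced_basis :: "('p \<Rightarrow> 'x::real_inner \<Rightarrow> bool) \<Rightarrow> 'p set \<Rightarrow> nat \<Rightarrow> (nat \<Rightarrow> 'x) \<Rightarrow> bool" where
  "reduced_basis is_adj P k \<phi> \<longleftrightarrow>
     lin_indep_family k \<phi> \<and>
     (\<exists>(\<nu> :: nat \<Rightarrow> 'p) \<psi>.
        (\<forall>i\<in>{1..k}. \<nu> i \<in> P \<and> is_adj (\<nu> i) (\<psi> i)) \<and>
        ((\<forall>i\<in>{1..k}. \<phi> i = \<psi> i) \<or> (\<forall>i\<in>{1..k}. \<phi> i = gram_schmidt \<psi> i)))"

definition approx_final_adjoint ::
  "('x::real_inner \<Rightarrow>\<^sub>L 'x) \<Rightarrow> 'x \<Rightarrow> nat \<Rightarrow> (nat \<Rightarrow> 'x) \<Rightarrow> 'x \<Rightarrow> bool" where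
  "approx_final_adjoint S b k \<phi> p \<longleftrightarrow>
     (\<exists>\<alpha> :: nat \<Rightarrow> real.
        orth_proj (span ((\<lambda>i. blinfun_apply S (\<phi> i)) ` {1..k})) b
          = (\<Sum>i\<in>{1..k}. \<alpha> i *\<^sub>R blinfun_apply S (\<phi> i)) \<and>
        p = (\<Sum>i\<in>{1..k}. \<alpha> i *\<^sub>R \<phi> i))"

end

theory Submission
  imports Defs
begin

text \<open>
  Write \<open>S = I + M \<Lambda>\<close> for the system operator and \<open>b = M (exp(T A) x\<^sub>0 - x\<^sub>T)\<close> for its right-hand side.
  Everything rests on the linear equation \<open>S p = b\<close> satisfied by the optimal final time adjoint
  \<open>p\<close> (\<open>optimal_final_adjoint_solves_system\<close>): the residual of any \<open>q\<close> is then
  \<open>b - S q = S (p - q)\<close>, so the error estimator measures the error through \<open>S\<close>.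

  The equation comes from the optimality system by variation of constants. The adjoint equation
  gives \<open>\<phi>(s) = exp((T - s) A\<^sup>*) \<phi>(T)\<close>; inserting the resulting control into the formula for
  \<open>x(T)\<close> produces the Gramian, \<open>x(T) = exp(T A) x\<^sub>0 - \<Lambda> \<phi>(T)\<close>, and the terminal condition does the rest.

  Since \<open>\<langle>M \<Lambda> q, q\<rangle> \<ge> 0\<close>, the operator \<open>S\<close> is coercive with constant 1, hence
  \<open>\<parallel>q\<parallel> \<le> \<parallel>S q\<parallel>\<close>. Applied to \<open>p - p\<^sub>r\<close>, where \<open>p\<^sub>r\<close> is the approximate adjoint, this bounds
  the distance of \<open>p\<close> to the reduced space by the estimator. Conversely, \<open>S p\<^sub>r\<close> is the
  orthogonal projection of \<open>b\<close> onto the image of the reduced space under \<open>S\<close>, so for every \<open>y\<close>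
  in the reduced space the estimator is at most \<open>\<parallel>b - S y\<parallel> = \<parallel>S (p - y)\<parallel> \<le> \<parallel>S\<parallel> \<parallel>p - y\<parallel>\<close>;
  take the infimum over \<open>y\<close>.
\<close>

section \<open>The exponential of a bounded operator\<close>

abbreviation blinfun_power :: "('a::real_normed_vector \<Rightarrow>\<^sub>L 'a) \<Rightarrow> nat \<Rightarrow> ('a \<Rightarrow>\<^sub>L 'a)" where
  "blinfun_power A n \<equiv> ((\<lambda>C. A o\<^sub>L C) ^^ n) id_blinfun"

lemma norm_blinfun_power_le: "norm (blinfun_power A n) \<le> norm A ^ n"
proof (induction n)
  case 0
  show ?case by (simp add: norm_blinfun_id_le)
next
  case (Suc n)
  have "norm (blinfun_power A (Suc n)) \<le> norm A * norm (blinfun_power A n)"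
    by (simp add: norm_blinfun_compose)
  also have "\<dots> \<le> norm A * norm A ^ n"
    by (intro mult_left_mono Suc) auto
  finally show ?case by simp
qed

lemma blinfun_power_Suc_right: "blinfun_power A (Suc n) = blinfun_power A n o\<^sub>L A"
proof (induction n)
  case 0
  show ?case by (auto intro: blinfun_eqI)
next
  case (Suc n)
  have "blinfun_power A (Suc (Suc n)) = A o\<^sub>L blinfun_power A (Suc n)"
    by simp
  also have "\<dots> = A o\<^sub>L (blinfun_power A n o\<^sub>L A)"
    by (simp only: Suc.IH)
  also have "\<dots> = (A o\<^sub>L blinfun_power A n) o\<^sub>L A"
    by (rule blinfun_eqI) simp
  finally show ?case by simp
qed

lemma blinfun_power_scaleR: "blinfun_power (t *\<^sub>R A) n = t ^ n *\<^sub>R blinfun_power A n"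
proof (induction n)
  case 0
  show ?case by simp
next
  case (Suc n)
  then show ?case by (auto intro!: blinfun_eqI simp: blinfun.bilinear_simps)
qed

lemma uniform_limit_blinfun_exp:
  fixes A :: "'a::banach \<Rightarrow>\<^sub>L 'a"
  shows "uniform_limit {-K..K} (\<lambda>n t. \<Sum>i<n. (t ^ i / fact i) *\<^sub>R blinfun_power A i)
    (\<lambda>t. blinfun_exp (t *\<^sub>R A)) sequentially"
proof -
  have "norm ((t ^ i / fact i) *\<^sub>R blinfun_power A i) \<le> (K * norm A) ^ i /\<^sub>R fact i"
    if "t \<in> {-K..K}" for i t
  proof -
    have "\<bar>t\<bar> ^ i * norm (blinfun_power A i) \<le> K ^ i * norm A ^ i"
      using that by (intro mult_mono power_mono norm_blinfun_power_le) auto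
    then show ?thesis
      by (simp add: abs_mult power_abs power_mult_distrib divide_inverse mult_ac mult_left_mono)
  qed
  from Weierstrass_m_test[OF this summable_exp_generic]
  have "uniform_limit {-K..K} (\<lambda>n t. \<Sum>i<n. (t ^ i / fact i) *\<^sub>R blinfun_power A i)
    (\<lambda>t. \<Sum>i. (t ^ i / fact i) *\<^sub>R blinfun_power A i) sequentially"
    .
  then show ?thesis
    by (simp add: blinfun_exp_def blinfun_power_scaleR)
qed

lemma blinfun_exp_zero: "blinfun_exp 0 = id_blinfun"
proof -
  have "(1 / fact n) *\<^sub>R blinfun_power (0::'a \<Rightarrow>\<^sub>L 'a) n = (if n = 0 then id_blinfun else 0)" for n
    by (cases n) auto
  then have "(\<lambda>n. (1 / fact n) *\<^sub>R blinfun_power (0::'a \<Rightarrow>\<^sub>L 'a) n) sums id_blinfun"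
    using sums_single[of 0 "\<lambda>_. id_blinfun"] by simp
  then show ?thesis
    unfolding blinfun_exp_def by (rule sums_unique[symmetric])
qed

text \<open>
  The series may be differentiated term by term because the differentiated series is again the
  exponential series, composed with \<open>A\<close>, and so converges uniformly on bounded intervals. The factor
  \<open>A\<close> is kept on the right: that is where it cancels against \<open>x' = A x\<close> in the variation of constants.
\<close>

lemma has_vector_derivative_blinfun_exp:
  fixes A :: "'a::banach \<Rightarrow>\<^sub>L 'a"
  shows "((\<lambda>t. blinfun_exp (t *\<^sub>R A)) has_vector_derivative blinfun_exp (t *\<^sub>R A) o\<^sub>L A) (at t)"
proof -
  define K where "K = \<bar>t\<bar> + 1"
  define f where "f n t = (t ^ n / fact n) *\<^sub>R blinfun_power A n" for n and t :: real
  define f' where "f' n t = (real n * t ^ (n - 1) / fact n) *\<^sub>R blinfun_power A n" for n and t :: real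
  have lim: "uniform_limit {-K..K} (\<lambda>n t. \<Sum>i<n. f i t) (\<lambda>t. blinfun_exp (t *\<^sub>R A)) sequentially"
    unfolding f_def by (rule uniform_limit_blinfun_exp)
  have f_sums: "(\<lambda>n. f n s) sums blinfun_exp (s *\<^sub>R A)" if "s \<in> {-K..K}" for s
    using tendsto_uniform_limitI[OF lim that] by (simp add: sums_def)
  have f'_Suc: "f' (Suc i) s = f i s o\<^sub>L A" for i s
  proof -
    have "f' (Suc i) s = (s ^ i / fact i) *\<^sub>R blinfun_power A (Suc i)"
      by (simp add: f'_def del: funpow.simps of_nat_Suc)
    also have "\<dots> = f i s o\<^sub>L A"
      unfolding blinfun_power_Suc_right f_def
      by (auto intro: blinfun_eqI simp: blinfun.bilinear_simps)
    finally show ?thesis .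
  qed
  have sum_f': "(\<Sum>i<Suc n. f' i s) = (\<Sum>i<n. f i s) o\<^sub>L A" for n s
    unfolding sum.lessThan_Suc_shift f'_Suc
    by (simp add: f'_def bounded_bilinear.sum_left[OF bounded_bilinear_blinfun_compose])
  have "\<exists>g. \<forall>s\<in>{-K..K}. (\<lambda>n. f n s) sums g s \<and>
      (g has_derivative (\<lambda>h. h *\<^sub>R (blinfun_exp (s *\<^sub>R A) o\<^sub>L A))) (at s within {-K..K})"
  proof (rule has_derivative_series[where f' = "\<lambda>n s h. h *\<^sub>R f' n s"])
    show "convex {-K..K}" "t \<in> {-K..K}" "(\<lambda>n. f n t) sums blinfun_exp (t *\<^sub>R A)"
      by (auto simp: K_def intro!: f_sums)
    show "(f n has_derivative (\<lambda>h. h *\<^sub>R f' n s)) (at s within {-K..K})" for n s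
      unfolding f_def f'_def by (auto intro!: derivative_eq_intros simp: mult_ac)
    fix e :: real
    assume "e > 0"
    then have "e / (norm A + 1) > 0"
      by (simp add: add_nonneg_pos)
    from uniform_limitD[OF lim this]
    have "\<forall>\<^sub>F n in sequentially. \<forall>s\<in>{-K..K}. \<forall>h.
      norm ((\<Sum>i<Suc n. h *\<^sub>R f' i s) - h *\<^sub>R (blinfun_exp (s *\<^sub>R A) o\<^sub>L A)) \<le> e * norm h"
    proof eventually_elim
      case (elim n)
      show ?case
      proof (intro ballI allI)
        fix s h :: real
        assume "s \<in> {-K..K}"
        define D where "D = (\<Sum>i<n. f i s) - blinfun_exp (s *\<^sub>R A)"
        have "norm D < e / (norm A + 1)"
          using elim \<open>s \<in> {-K..K}\<close> by (simp add: D_def dist_norm)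
        then have "norm D * norm A \<le> e / (norm A + 1) * norm A"
          by (intro mult_right_mono) auto
        also have "\<dots> \<le> e"
          using \<open>e > 0\<close> by (simp add: divide_le_eq add_nonneg_pos distrib_left)
        finally have "norm (D o\<^sub>L A) \<le> e"
          using norm_blinfun_compose[of D A] by linarith
        moreover have "(\<Sum>i<Suc n. h *\<^sub>R f' i s) - h *\<^sub>R (blinfun_exp (s *\<^sub>R A) o\<^sub>L A) = h *\<^sub>R (D o\<^sub>L A)"
          unfolding scaleR_sum_right[symmetric] sum_f'
          by (simp add: D_def scaleR_diff_right
              bounded_bilinear.diff_left[OF bounded_bilinear_blinfun_compose])
        ultimately show "norm ((\<Sum>i<Suc n. h *\<^sub>R f' i s) - h *\<^sub>R (blinfun_exp (s *\<^sub>R A) o\<^sub>L A)) \<le> e * norm h"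
          by (simp add: mult.commute[of e] mult_left_mono)
      qed
    qed
    then show "\<forall>\<^sub>F n in sequentially. \<forall>s\<in>{-K..K}. \<forall>h.
      norm ((\<Sum>i<n. h *\<^sub>R f' i s) - h *\<^sub>R (blinfun_exp (s *\<^sub>R A) o\<^sub>L A)) \<le> e * norm h"
      by (subst (asm) eventually_sequentially_Suc)
  qed
  then obtain g where g: "\<And>s. s \<in> {-K..K} \<Longrightarrow> (\<lambda>n. f n s) sums g s"
    "\<And>s. s \<in> {-K..K} \<Longrightarrow>
      (g has_vector_derivative blinfun_exp (s *\<^sub>R A) o\<^sub>L A) (at s within {-K..K})"
    unfolding has_vector_derivative_def by blast
  have t: "t \<in> {-K<..<K}" by (auto simp: K_def)
  have "(g has_vector_derivative blinfun_exp (t *\<^sub>R A) o\<^sub>L A) (at t)"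
    using g(2)[of t] t by (simp add: at_within_Icc_at)
  then show ?thesis
  proof (rule has_vector_derivative_transform_within_open[OF _ _ t])
    show "g s = blinfun_exp (s *\<^sub>R A)" if "s \<in> {-K<..<K}" for s
      using that g(1)[of s] f_sums[of s] by (intro sums_unique2[of "\<lambda>n. f n s"]) auto
  qed simp
qed

lemma continuous_on_blinfun_exp:
  fixes A :: "'a::banach \<Rightarrow>\<^sub>L 'a"
  assumes "continuous_on S f"
  shows "continuous_on S (\<lambda>s. blinfun_exp (f s *\<^sub>R A))"
proof -
  have "continuous_on UNIV (\<lambda>t. blinfun_exp (t *\<^sub>R A))"
    by (intro continuous_at_imp_continuous_on ballI
        has_vector_derivative_continuous[OF has_vector_derivative_blinfun_exp])
  from continuous_on_compose2[OF this assms] show ?thesis by simp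
qed

section \<open>The optimality system\<close>

text \<open>
  Variation of constants: the derivative of \<open>s \<mapsto> exp((c - s) A) x(s)\<close> is the integrand, as the two terms
  containing \<open>A\<close> cancel. The choice \<open>c = b\<close> solves for the final state, the choice \<open>c = a\<close> for the
  initial state.
\<close>

lemma variation_of_constants:
  fixes A :: "'a::banach \<Rightarrow>\<^sub>L 'a"
  assumes "a \<le> b"
    and x: "\<And>s. s \<in> {a..b} \<Longrightarrow>
      (x has_vector_derivative blinfun_apply A (x s) + f s) (at s within {a..b})"
  shows "((\<lambda>s. blinfun_exp ((c - s) *\<^sub>R A) (f s)) has_integral
    blinfun_exp ((c - b) *\<^sub>R A) (x b) - blinfun_exp ((c - a) *\<^sub>R A) (x a)) {a..b}"
proof (rule fundamental_theorem_of_calculus[OF \<open>a \<le> b\<close>])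
  fix s
  assume s: "s \<in> {a..b}"
  have "((\<lambda>s. c - s) has_vector_derivative -1) (at s within {a..b})"
    by (auto intro!: derivative_eq_intros)
  from vector_diff_chain_within[OF this
      has_vector_derivative_at_within[OF has_vector_derivative_blinfun_exp[of A "c - s"]]]
  have E: "((\<lambda>s. blinfun_exp ((c - s) *\<^sub>R A)) has_vector_derivative
      - (blinfun_exp ((c - s) *\<^sub>R A) o\<^sub>L A)) (at s within {a..b})"
    by (simp add: o_def)
  show "((\<lambda>s. blinfun_exp ((c - s) *\<^sub>R A) (x s)) has_vector_derivative
      blinfun_exp ((c - s) *\<^sub>R A) (f s)) (at s within {a..b})"
    using bounded_bilinear.has_vector_derivative[OF bounded_bilinear_blinfun_apply E x[OF s]]
    by (simp add: blinfun.bilinear_simps)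
qed

text \<open>
  Variation of constants for \<open>-A\<close> on \<open>[s, b]\<close> with \<open>c = s\<close> and zero forcing; the two signs in
  \<open>(s - b) (-A)\<close> cancel to \<open>(b - s) A\<close>.
\<close>

lemma adjoint_state_eq_exp:
  fixes A :: "'a::banach \<Rightarrow>\<^sub>L 'a"
  assumes "s \<in> {a..b}"
    and \<phi>: "\<And>t. t \<in> {a..b} \<Longrightarrow>
      (\<phi> has_vector_derivative - blinfun_apply A (\<phi> t)) (at t within {a..b})"
  shows "\<phi> s = blinfun_exp ((b - s) *\<^sub>R A) (\<phi> b)"
proof -
  have "(\<phi> has_vector_derivative blinfun_apply (- A) (\<phi> t) + 0) (at t within {s..b})"
    if "t \<in> {s..b}" for t
    using that \<open>s \<in> {a..b}\<close>
    by (auto simp: blinfun.minus_left intro: has_vector_derivative_within_subset[OF \<phi>])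
  from variation_of_constants[OF _ this, where c = s]
  have "((\<lambda>t. 0) has_integral
      blinfun_exp ((s - b) *\<^sub>R - A) (\<phi> b) - blinfun_exp 0 (\<phi> s)) {s..b}"
    using \<open>s \<in> {a..b}\<close> by (simp add: blinfun.bilinear_simps)
  then have "blinfun_exp ((s - b) *\<^sub>R - A) (\<phi> b) - blinfun_exp 0 (\<phi> s) = 0"
    by (rule has_integral_unique) simp
  moreover have "(s - b) *\<^sub>R - A = (b - s) *\<^sub>R A"
    by (simp add: algebra_simps)
  ultimately show ?thesis
    by (simp add: blinfun_exp_zero)
qed

text \<open>
  The Gramian is an integral in operator space; evaluation at a vector is bounded linear and commutes
  with the integral, which exists because the integrand is continuous.
\<close>

lemma has_integral_gramian_apply:
  "((\<lambda>s. blinfun_exp ((T - s) *\<^sub>R A) (B (blinfun_inverse R (hilbert_adjoint B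
      (blinfun_exp ((T - s) *\<^sub>R hilbert_adjoint A) p))))) has_integral gramian T A B R p) {0..T}"
proof -
  let ?F = "\<lambda>s. blinfun_exp ((T - s) *\<^sub>R A) o\<^sub>L B o\<^sub>L blinfun_inverse R o\<^sub>L hilbert_adjoint B
       o\<^sub>L blinfun_exp ((T - s) *\<^sub>R hilbert_adjoint A)"
  have "continuous_on {0..T} ?F"
    by (intro bounded_bilinear.continuous_on[OF bounded_bilinear_blinfun_compose]
        continuous_on_blinfun_exp continuous_intros)
  then have "(?F has_integral gramian T A B R) {0..T}"
    unfolding gramian_def by (intro integrable_integral integrable_continuous_interval)
  from has_integral_linear[OF this
      bounded_bilinear.bounded_linear_left[OF bounded_bilinear_blinfun_apply, of p]]
  show ?thesis by (simp add: o_def)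
qed

lemma optimal_final_adjoint_solves_system:
  assumes "T > 0" and opt: "optimal_final_adjoint T A B R M x0 xT p"
  shows "system_op T A B R M p = system_rhs T A M x0 xT"
proof -
  obtain x \<phi> u where
    x: "\<And>t. t \<in> {0..T} \<Longrightarrow>
      (x has_vector_derivative blinfun_apply A (x t) + blinfun_apply B (u t)) (at t within {0..T})"
    and \<phi>: "\<And>t. t \<in> {0..T} \<Longrightarrow>
      (\<phi> has_vector_derivative - blinfun_apply (hilbert_adjoint A) (\<phi> t)) (at t within {0..T})"
    and u: "\<And>t. t \<in> {0..T} \<Longrightarrow> u t = - blinfun_inverse R (hilbert_adjoint B (\<phi> t))"
    and ends: "x 0 = x0" "\<phi> T = M (x T - xT)" "p = \<phi> T"
    using opt unfolding optimal_final_adjoint_def by blast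
  have "((\<lambda>s. blinfun_exp ((T - s) *\<^sub>R A) (B (u s))) has_integral
      blinfun_exp ((T - T) *\<^sub>R A) (x T) - blinfun_exp ((T - 0) *\<^sub>R A) (x 0)) {0..T}"
    using \<open>T > 0\<close> by (intro variation_of_constants x) auto
  then have "((\<lambda>s. blinfun_exp ((T - s) *\<^sub>R A) (B (u s))) has_integral
      x T - blinfun_exp (T *\<^sub>R A) x0) {0..T}"
    by (simp add: blinfun_exp_zero ends(1))
  moreover have "blinfun_exp ((T - s) *\<^sub>R A) (B (u s)) =
      - blinfun_exp ((T - s) *\<^sub>R A) (B (blinfun_inverse R (hilbert_adjoint B
          (blinfun_exp ((T - s) *\<^sub>R hilbert_adjoint A) p))))" if "s \<in> {0..T}" for s
    using adjoint_state_eq_exp[OF that \<phi>] u[OF that] ends(3) by (simp add: blinfun.bilinear_simps)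
  ultimately have "((\<lambda>s. - blinfun_exp ((T - s) *\<^sub>R A) (B (blinfun_inverse R (hilbert_adjoint B
      (blinfun_exp ((T - s) *\<^sub>R hilbert_adjoint A) p))))) has_integral
      x T - blinfun_exp (T *\<^sub>R A) x0) {0..T}"
    by (rule has_integral_eq[rotated])
  from has_integral_unique[OF this has_integral_neg[OF has_integral_gramian_apply]]
  have xT_eq: "x T = blinfun_exp (T *\<^sub>R A) x0 - gramian T A B R p"
    by (simp add: algebra_simps)
  have "p = M (x T - xT)"
    by (simp only: ends(2,3))
  also have "\<dots> = system_rhs T A M x0 xT - M (gramian T A B R p)"
    unfolding xT_eq system_rhs_def by (simp add: blinfun.bilinear_simps)
  finally have "p + M (gramian T A B R p) = system_rhs T A M x0 xT"
    by (simp only: eq_diff_eq)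
  then show ?thesis
    by (simp add: system_op_def blinfun.add_left)
qed

section \<open>Coercivity, best approximation and distance\<close>

lemma norm_le_norm_id_plus_pos_semidef:
  assumes "pos_semidef C"
  shows "norm p \<le> norm ((id_blinfun + C) p)"
proof -
  have "norm p * norm p \<le> inner ((id_blinfun + C) p) p"
    using assms
    by (simp add: pos_semidef_def blinfun.add_left inner_add_left
        norm_eq_sqrt_inner)
  also have "\<dots> \<le> norm ((id_blinfun + C) p) * norm p"
    by (rule norm_cauchy_schwarz)
  finally show ?thesis
    by (cases "p = 0") auto
qed

lemma orthogonal_residual_imp_best:
  assumes "subspace Y" "y \<in> Y" "z \<in> Y" and orth: "\<forall>w\<in>Y. inner (b - y) w = 0"
  shows "norm (b - y) \<le> norm (b - z)"
proof -
  have "inner (b - y) (y - z) = 0"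
    using assms by (simp add: subspace_diff)
  then have "(norm (b - z))\<^sup>2 = (norm (b - y))\<^sup>2 + (norm (y - z))\<^sup>2"
    using norm_add_Pythagorean[of "b - y" "y - z"] by (simp add: orthogonal_def)
  then have "(norm (b - y))\<^sup>2 \<le> (norm (b - z))\<^sup>2"
    by simp
  then show ?thesis
    by (rule power2_le_imp_le) simp
qed

text \<open>
  Inside an infinite-dimensional space the projection onto a finite-dimensional subspace is still
  available as the Fourier sum over an orthogonal spanning set. A spanning vector \<open>c = 0\<close> is harmless:
  its coefficient is \<open>0\<close> by the convention on division by zero.
\<close>

lemma orth_residual_exists_span:
  fixes b :: "'a::real_inner"
  assumes "finite S"
  shows "\<exists>y\<in>span S. \<forall>z\<in>span S. inner (b - y) z = 0"
proof -
  obtain C where C: "finite C" "span C = span S" "pairwise orthogonal C"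
    using basis_orthogonal[OF assms] by blast
  define y where "y = (\<Sum>c\<in>C. (inner b c / inner c c) *\<^sub>R c)"
  have "inner y d = inner b d" if "d \<in> C" for d
  proof -
    have "inner y d = (\<Sum>c\<in>C. if c = d then inner b d else 0)"
      unfolding y_def inner_sum_left
      using C(3) that by (intro sum.cong) (auto simp: pairwise_def orthogonal_def)
    then show ?thesis
      using C(1) that by simp
  qed
  then have "orthogonal (b - y) z" if "z \<in> span C" for z
    by (intro orthogonal_to_span[OF that]) (simp add: orthogonal_def inner_diff_left)
  moreover have "y \<in> span S"
    unfolding y_def C(2)[symmetric] by (intro span_sum span_scale span_base)
  ultimately show ?thesis
    unfolding C(2) orthogonal_def by blast
qed

lemma orth_proj_span:
  fixes b :: "'a::real_inner"
  assumes "finite S"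
  shows "orth_proj (span S) b \<in> span S \<and> (\<forall>z\<in>span S. inner (b - orth_proj (span S) b) z = 0)"
  unfolding orth_proj_def
proof (rule theI')
  show "\<exists>!y. y \<in> span S \<and> (\<forall>z\<in>span S. inner (b - y) z = 0)"
  proof (rule ex_ex1I)
    show "\<exists>y. y \<in> span S \<and> (\<forall>z\<in>span S. inner (b - y) z = 0)"
      using orth_residual_exists_span[OF assms] by blast
    fix y y'
    assume y: "y \<in> span S \<and> (\<forall>z\<in>span S. inner (b - y) z = 0)"
      and y': "y' \<in> span S \<and> (\<forall>z\<in>span S. inner (b - y') z = 0)"
    then have "inner ((b - y') - (b - y)) (y - y') = 0"
      unfolding inner_diff_left[of "b - y'"] by (simp add: span_diff)
    then show "y = y'" by simp
  qed
qed

text \<open>Applying \<open>S\<close> to the approximate adjoint gives the projection of \<open>b\<close> onto the image of the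
  reduced space under \<open>S\<close>, and a projection is a best approximation.\<close>

lemma approx_final_adjoint_minimises_residual:
  fixes S :: "'a::real_inner \<Rightarrow>\<^sub>L 'a"
  assumes "approx_final_adjoint S b k \<phi> p"
  shows "p \<in> span (\<phi> ` {1..k})"
    and "y \<in> span (\<phi> ` {1..k}) \<Longrightarrow> norm (b - S p) \<le> norm (b - S y)"
proof -
  let ?Y = "span ((\<lambda>i. S (\<phi> i)) ` {1..k})"
  obtain \<alpha> where \<alpha>: "orth_proj ?Y b = (\<Sum>i\<in>{1..k}. \<alpha> i *\<^sub>R S (\<phi> i))"
    and p: "p = (\<Sum>i\<in>{1..k}. \<alpha> i *\<^sub>R \<phi> i)"
    using assms unfolding approx_final_adjoint_def by blast
  show "p \<in> span (\<phi> ` {1..k})"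
    unfolding p by (intro span_sum span_scale span_base imageI)
  assume y: "y \<in> span (\<phi> ` {1..k})"
  have "linear S"
    by (rule bounded_linear.linear[OF blinfun.bounded_linear_right])
  then have "?Y = S ` span (\<phi> ` {1..k})"
    using linear_span_image[of S "\<phi> ` {1..k}"] by (simp add: image_image)
  with y have "S y \<in> ?Y" by blast
  moreover have "S p = orth_proj ?Y b"
    unfolding \<alpha> p by (simp add: blinfun.sum_right blinfun.scaleR_right)
  ultimately show "norm (b - S p) \<le> norm (b - S y)"
    using orth_proj_span[of "(\<lambda>i. S (\<phi> i)) ` {1..k}" b]
    by (intro orthogonal_residual_imp_best[of ?Y]) auto
qed

lemma set_deviation_singleton: "set_deviation Y {z} = (INF y\<in>Y. norm (y - z))"
  by (simp add: set_deviation_def)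

lemma set_deviation_singleton_le: "y \<in> Y \<Longrightarrow> set_deviation Y {z} \<le> norm (y - z)"
  unfolding set_deviation_singleton by (rule cINF_lower) (auto intro: bdd_belowI2[where m = 0])

lemma le_mult_set_deviation_singleton:
  assumes "Y \<noteq> {}" "c \<ge> 0" and le: "\<And>y. y \<in> Y \<Longrightarrow> r \<le> c * norm (y - z)"
  shows "r \<le> c * set_deviation Y {z}"
proof (cases "c = 0")
  case True
  with assms show ?thesis by auto
next
  case False
  with \<open>c \<ge> 0\<close> have "c > 0" by simp
  then have "r / c \<le> set_deviation Y {z}"
    unfolding set_deviation_singleton
    using le by (intro cINF_greatest \<open>Y \<noteq> {}\<close>) (simp add: pos_divide_le_eq mult.commute)
  with \<open>c > 0\<close> show ?thesis
    by (simp add: pos_divide_le_eq mult.commute)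
qed

section \<open>The two-sided estimate\<close>

theorem theorem3:
  fixes T :: real
    and P :: "'p::banach set"
    and A :: "'p \<Rightarrow> ('x::{real_inner,banach} \<Rightarrow>\<^sub>L 'x)"
    and B :: "'p \<Rightarrow> ('u::{real_inner,banach} \<Rightarrow>\<^sub>L 'x)"
    and x0 xT :: "'p \<Rightarrow> 'x"
    and M :: "'x \<Rightarrow>\<^sub>L 'x"
    and R :: "'u \<Rightarrow>\<^sub>L 'u"
    and \<mu> :: 'p
    and k :: nat
    and \<phi> :: "nat \<Rightarrow> 'x"
    and p_opt p_red :: 'x
  assumes "T > 0"
    and "compact P"
    and "\<exists>L. L-lipschitz_on P A"
    and "\<exists>L. L-lipschitz_on P B"
    and "\<exists>L. L-lipschitz_on P x0"
    and "\<exists>L. L-lipschitz_on P xT"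
    and "self_adjoint M" and "pos_semidef M"
    and "self_adjoint R"
    and "\<exists>\<alpha>>0. pos_semidef (R - \<alpha> *\<^sub>R id_blinfun)"
    and "\<forall>\<nu>\<in>P. pos_semidef (M o\<^sub>L gramian T (A \<nu>) (B \<nu>) R)"
    and "\<mu> \<in> P"
    and "optimal_final_adjoint T (A \<mu>) (B \<mu>) R M (x0 \<mu>) (xT \<mu>) p_opt"
    and "reduced_basis
           (\<lambda>\<nu>. optimal_final_adjoint T (A \<nu>) (B \<nu>) R M (x0 \<nu>) (xT \<nu>)) P k \<phi>"
    and "approx_final_adjoint (system_op T (A \<mu>) (B \<mu>) R M)
           (system_rhs T (A \<mu>) M (x0 \<mu>) (xT \<mu>)) k \<phi> p_red"
  shows "set_deviation (span (\<phi> ` {1..k})) {p_opt}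
           \<le> error_estimator T (A \<mu>) (B \<mu>) R M (x0 \<mu>) (xT \<mu>) p_red
       \<and> error_estimator T (A \<mu>) (B \<mu>) R M (x0 \<mu>) (xT \<mu>) p_red
           \<le> norm (system_op T (A \<mu>) (B \<mu>) R M) * set_deviation (span (\<phi> ` {1..k})) {p_opt}"
proof -
  let ?S = "system_op T (A \<mu>) (B \<mu>) R M"
  let ?b = "system_rhs T (A \<mu>) M (x0 \<mu>) (xT \<mu>)"
  let ?X = "span (\<phi> ` {1..k})"
  let ?\<eta> = "error_estimator T (A \<mu>) (B \<mu>) R M (x0 \<mu>) (xT \<mu>)"
  note min = approx_final_adjoint_minimises_residual[OF assms(15)]
  have "blinfun_apply ?S p_opt = ?b"
    using assms(1,13) by (rule optimal_final_adjoint_solves_system)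
  then have residual: "norm (?b - blinfun_apply ?S q) = norm (blinfun_apply ?S (q - p_opt))" for q
    by (simp add: blinfun.diff_right norm_minus_commute)
  have "pos_semidef (M o\<^sub>L gramian T (A \<mu>) (B \<mu>) R)"
    using assms(11,12) by blast
  then have "norm (p_red - p_opt) \<le> norm (blinfun_apply ?S (p_red - p_opt))"
    unfolding system_op_def by (rule norm_le_norm_id_plus_pos_semidef)
  then have "set_deviation ?X {p_opt} \<le> ?\<eta> p_red"
    unfolding error_estimator_def residual using set_deviation_singleton_le[OF min(1)]
    by (rule order_trans[rotated])
  moreover have "?\<eta> p_red \<le> norm ?S * set_deviation ?X {p_opt}"
  proof (rule le_mult_set_deviation_singleton)
    show "?X \<noteq> {}" using span_zero by blast
    show "?\<eta> p_red \<le> norm ?S * norm (y - p_opt)" if "y \<in> ?X" for y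
      using min(2)[OF that] norm_blinfun[of ?S "y - p_opt"]
      unfolding error_estimator_def residual by linarith
  qed simp
  ultimately show ?thesis ..
qed

end
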